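(* Assume that $F$ is strongly convex, i.e. for every $j\in\mathcal{J}$ there is $\mu_j>0$ such that $F_j(y)\ge F_j(x)+\langle\nabla F_j(x),y-x\rangle+\frac{\mu_j}{2}\|y-x\|^2$ for all $x,y\in\mathcal{X}$, and put $\mu:=\min_{j\in\mathcal{J}}\mu_j$. Let $(x^k)_{k\in\mathbb{N}}$ be the infinite sequence generated by the M-FW algorithm, let $x^*$ be its limit point, and assume $x^*\in\mathrm{relint}(\mathcal{X})$. Let $r>0$ and $k_0\in\mathbb{N}$ be such that $B(x^*,2r)\cap\mathrm{aff}(\mathcal{X})\subset\mathcal{X}$ and $x^k\in B(x^*,r)$ for all $k\ge k_0$. Then $$\hat h(x^{k+1})\le\left[1-\frac{\mu r^2}{L D_{\mathcal{X}}^2}\right]\hat h(x^k),\qquad\forall k\ge k_0,$$ and $$\sum_{i=\ell}^{k}|\theta^{FW}(x^i)|^2\le 2L D_{\mathcal{X}}^2\,\hat h(x^\ell),\qquad\forall k\ge \ell\ge 1.$$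
   Context: Setting. $\mathcal{Y}$ is a finite-dimensional real vector space with an inner product $\langle\cdot,\cdot\rangle$ and a norm $\|\cdot\|$ (not necessarily induced by the inner product); gradients are taken with respect to $\langle\cdot,\cdot\rangle$. $\mathcal{X}\subset\mathcal{Y}$ is nonempty, convex and compact, $D_{\mathcal{X}}:=\max\{\|x-y\|:x,y\in\mathcal{X}\}$, $\mathcal{J}:=\{1,\dots,m\}$, and the problem is $\min_{x\in\mathcal{X}}F(x)=(F_1(x),\dots,F_m(x))$. Standing assumption: for every $j\in\mathcal{J}$, $F_j:V\to\mathbb{R}$ is convex and continuously differentiable ($V\subset\mathcal{Y}$ an open set containing $\mathcal{X}$) and $L_j$-smooth over $\mathcal{X}$, i.e. $$F_j(x)+\langle\nabla F_j(x),y-x\rangle\le F_j(y)\le F_j(x)+\langle\nabla F_j(x),y-x\rangle+\tfrac{L_j}{2}\|y-x\|^2\quad\forall x,y\in\mathcal{X}.$$ Set $L:=\max_{j\in\mathcal{J}}L_j>0$. $\mathbb{N}$ contains $0$. Multiobjective Frank-Wolfe (M-FW) algorithm. Start from $x^0\in\mathcal{X}$. At iteration $k$ choose $p^{FW}(x^k)\in\arg\min_{y\in\mathcal{X}}\max_{j\in\mathcal{J}}\langle\nabla F_j(x^k),y-x^k\rangle$, and let $d^{FW}(x^k):=p^{FW}(x^k)-x^k$, $\theta^{FW}(x^k):=\max_{j\in\mathcal{J}}\langle\nabla F_j(x^k),d^{FW}(x^k)\rangle$ (always $\le 0$). If $\theta^{FW}(x^k)=0$, stop. Otherwise set $\gamma_k:=\min\left\{1,\frac{-\theta^{FW}(x^k)}{L\|d^{FW}(x^k)\|^2}\right\}$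 and $x^{k+1}:=x^k+\gamma_k d^{FW}(x^k)$. It is assumed that the algorithm never stops, so it generates an infinite sequence $(x^k)_{k\in\mathbb{N}}$ with $\theta^{FW}(x^k)<0$ for all $k$. Fix a limit point $x^*$ of $(x^k)_{k\in\mathbb{N}}$ (under strong convexity the whole sequence converges to $x^*$) and define $h_j(x^k):=F_j(x^k)-F_j(x^* )$ and $\hat h(x^k):=\min_{j\in\mathcal{J}}h_j(x^k)$. $B(x,\epsilon)=\{y\in\mathcal{Y}:\|x-y\|\le\epsilon\}$; $\mathrm{aff}(\mathcal{X})$ is the affine hull of $\mathcal{X}$; $\mathrm{relint}(\mathcal{X})=\{x\in\mathcal{X}:\exists\,\epsilon>0,\ B(x,\epsilon)\cap\mathrm{aff}(\mathcal{X})\subseteq\mathcal{X}\}$. *)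

theory Defs
  imports "HOL-Analysis.Analysis"
begin

text \<open>
  The ambient space is a type of class \<open>euclidean_space\<close>; its inner product is the one used for
  gradients. The norm of the problem need not be induced by this inner product, so it is a separate
  function \<open>N\<close>. Openness, compactness, continuity, limits and \<^const>\<open>rel_interior\<close> do not depend on
  the choice of norm in finite dimension and are the library's notions (for the relative interior
  see \<open>mem_rel_interior_norm_ball\<close> below).
\<close>

definition is_norm :: "('a::real_vector \<Rightarrow> real) \<Rightarrow> bool" where
  "is_norm N \<longleftrightarrow>
     (\<forall>x. 0 \<le> N x) \<and> (\<forall>x. N x = 0 \<longleftrightarrow> x = 0) \<and>
     (\<forall>c x. N (c *\<^sub>R x) = \<bar>c\<bar> * N x) \<and> (\<forall>x y. N (x + y) \<le> N x + N y)"

definition norm_ball :: "('a::real_vector \<Rightarrow> real) \<Rightarrow> 'a \<Rightarrow> real \<Rightarrow> 'a set" where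
  "norm_ball N x e = {y. N (x - y) \<le> e}"

text \<open>The supremum is a maximum when \<open>X\<close> is nonempty and compact.\<close>

definition norm_diameter :: "('a::real_vector \<Rightarrow> real) \<Rightarrow> 'a set \<Rightarrow> real" where
  "norm_diameter N X = (SUP (x, y) \<in> X \<times> X. N (x - y))"

definition gradient :: "('a::euclidean_space \<Rightarrow> real) \<Rightarrow> 'a \<Rightarrow> 'a" where
  "gradient f x = (THE D. GDERIV f x :> D)"

definition continuously_differentiable_on ::
    "'a::euclidean_space set \<Rightarrow> ('a \<Rightarrow> real) \<Rightarrow> bool" where
  "continuously_differentiable_on V f \<longleftrightarrow>
     (\<forall>x\<in>V. f differentiable (at x)) \<and> continuous_on V (gradient f)"

definition convex_smooth_on ::
    "('a::euclidean_space \<Rightarrow> real) \<Rightarrow> real \<Rightarrow> 'a set \<Rightarrow> ('a \<Rightarrow> real) \<Rightarrow> bool" where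
  "convex_smooth_on N L X f \<longleftrightarrow>
     (\<forall>x\<in>X. \<forall>y\<in>X. f x + gradient f x \<bullet> (y - x) \<le> f y \<and>
        f y \<le> f x + gradient f x \<bullet> (y - x) + L / 2 * (N (y - x))\<^sup>2)"

definition strongly_convex_with ::
    "('a::euclidean_space \<Rightarrow> real) \<Rightarrow> real \<Rightarrow> 'a set \<Rightarrow> ('a \<Rightarrow> real) \<Rightarrow> bool" where
  "strongly_convex_with N \<mu> X f \<longleftrightarrow>
     (\<forall>x\<in>X. \<forall>y\<in>X. f y \<ge> f x + gradient f x \<bullet> (y - x) + \<mu> / 2 * (N (y - x))\<^sup>2)"

definition lin_max :: "nat \<Rightarrow> (nat \<Rightarrow> 'a::euclidean_space \<Rightarrow> real) \<Rightarrow> 'a \<Rightarrow> 'a \<Rightarrow> real" where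
  "lin_max m F x y = (MAX j\<in>{1..m}. gradient (F j) x \<bullet> (y - x))"

text \<open>
  An infinite run of the algorithm: \<open>p k\<close> is the chosen minimiser of the linearised subproblem at
  \<open>x k\<close>, so that \<open>\<theta>\<^sup>F\<^sup>W(x k) = lin_max m F (x k) (p k)\<close>.
\<close>

definition mfw_step_size ::
    "('a::euclidean_space \<Rightarrow> real) \<Rightarrow> real \<Rightarrow> nat \<Rightarrow> (nat \<Rightarrow> 'a \<Rightarrow> real) \<Rightarrow> 'a \<Rightarrow> 'a \<Rightarrow> real" where
  "mfw_step_size N L m F x p = min 1 (- lin_max m F x p / (L * (N (p - x))\<^sup>2))"

definition mfw_run ::
    "('a::euclidean_space \<Rightarrow> real) \<Rightarrow> real \<Rightarrow> nat \<Rightarrow> (nat \<Rightarrow> 'a \<Rightarrow> real) \<Rightarrow> 'a set \<Rightarrow>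
     (nat \<Rightarrow> 'a) \<Rightarrow> (nat \<Rightarrow> 'a) \<Rightarrow> bool" where
  "mfw_run N L m F X x p \<longleftrightarrow>
     x 0 \<in> X \<and>
     (\<forall>k. is_arg_min (lin_max m F (x k)) (\<lambda>y. y \<in> X) (p k) \<and>
          lin_max m F (x k) (p k) < 0 \<and>
          x (Suc k) = x k + mfw_step_size N L m F (x k) (p k) *\<^sub>R (p k - x k))"

definition min_gap :: "nat \<Rightarrow> (nat \<Rightarrow> 'a \<Rightarrow> real) \<Rightarrow> 'a \<Rightarrow> 'a \<Rightarrow> real" where
  "min_gap m F xs x = (MIN j\<in>{1..m}. F j x - F j xs)"

lemma GDERIV_gradient:
  fixes f :: "'a::euclidean_space \<Rightarrow> real"
  assumes "f differentiable (at x)"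
  shows "GDERIV f x :> gradient f x"
proof -
  obtain f' where f': "(f has_derivative f') (at x)"
    using assms by (auto simp: differentiable_def)
  have lin: "linear f'"
    using f' has_derivative_linear by blast
  have "f' = (\<lambda>h. h \<bullet> adjoint f' 1)"
    using adjoint_works[OF lin, of _ 1] by (intro ext) simp
  then have ex: "GDERIV f x :> adjoint f' 1"
    using f' by (metis gderiv_def)
  have "D = adjoint f' 1" if "GDERIV f x :> D" for D
  proof -
    have "(\<lambda>h. h \<bullet> D) = (\<lambda>h. h \<bullet> adjoint f' 1)"
      using that ex has_derivative_unique unfolding gderiv_def by blast
    then have "\<forall>h. h \<bullet> D = h \<bullet> adjoint f' 1" by meson
    then show ?thesis by (simp only: vector_eq_ldot)
  qed
  then show ?thesis
    unfolding gradient_def using ex theI[of "\<lambda>D. GDERIV f x :> D"] by blast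
qed

lemma is_norm_equivalent:
  fixes N :: "'a::euclidean_space \<Rightarrow> real"
  assumes "is_norm N"
  obtains a b where "a > 0" "b > 0" "\<And>x. N x \<le> b * norm x" "\<And>x. norm x \<le> a * N x"
proof -
  have nonneg: "0 \<le> N x" and zero: "N x = 0 \<longleftrightarrow> x = 0"
    and scale: "N (c *\<^sub>R x) = \<bar>c\<bar> * N x" and tri: "N (x + y) \<le> N x + N y" for c x y
    using assms by (auto simp: is_norm_def)
  have "convex_on UNIV N"
    unfolding convex_on_def using order_trans[OF tri] by (auto simp: scale)
  then have cont: "continuous_on UNIV N"
    using convex_on_continuous by blast
  have cs: "compact (sphere (0::'a) 1)" "sphere (0::'a) 1 \<noteq> {}" by auto
  have cont': "continuous_on (sphere 0 1) N"
    using cont continuous_on_subset by blast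
  obtain u where u: "u \<in> sphere 0 1" "\<And>x. x \<in> sphere 0 1 \<Longrightarrow> N x \<le> N u"
    using continuous_attains_sup[OF cs cont'] by blast
  obtain l where l: "l \<in> sphere 0 1" "\<And>x. x \<in> sphere 0 1 \<Longrightarrow> N l \<le> N x"
    using continuous_attains_inf[OF cs cont'] by blast
  have pos: "N l > 0" "N u > 0"
    using u(1) l(1) nonneg zero by (auto simp: less_le)
  have N_eq: "N x = norm x * N (x /\<^sub>R norm x)" if "x \<noteq> 0" for x
    using that by (simp add: scale)
  have N0: "N 0 = 0" using zero by simp
  have upper: "N x \<le> N u * norm x" for x
  proof (cases "x = 0")
    case False
    then have "N (x /\<^sub>R norm x) \<le> N u" by (intro u(2)) simp
    then have "norm x * N (x /\<^sub>R norm x) \<le> norm x * N u"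
      by (intro mult_left_mono) auto
    then show ?thesis using N_eq[OF False] by (simp only: mult.commute)
  qed (simp add: N0)
  have lower: "N l * norm x \<le> N x" for x
  proof (cases "x = 0")
    case False
    then have "N l \<le> N (x /\<^sub>R norm x)" by (intro l(2)) simp
    then have "norm x * N l \<le> norm x * N (x /\<^sub>R norm x)"
      by (intro mult_left_mono) auto
    then show ?thesis using N_eq[OF False] by (simp only: mult.commute)
  qed (simp add: N0)
  show thesis
  proof (rule that[of "inverse (N l)" "N u"])
    show "norm x \<le> inverse (N l) * N x" for x
      using lower[of x] pos by (simp add: field_simps)
  qed (use pos upper in auto)
qed

lemma mem_rel_interior_norm_ball:
  fixes X :: "'a::euclidean_space set"
  assumes "is_norm N"
  shows "x \<in> rel_interior X \<longleftrightarrow> x \<in> X \<and> (\<exists>e>0. norm_ball N x e \<inter> affine hull X \<subseteq> X)"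
proof -
  obtain a b where ab: "a > 0" "b > 0" "\<And>x. N x \<le> b * norm x" "\<And>x. norm x \<le> a * N x"
    using is_norm_equivalent[OF assms] by blast
  have 1: "norm_ball N x (e / a) \<subseteq> cball x e" for e
  proof
    fix y assume "y \<in> norm_ball N x (e / a)"
    then have "a * N (x - y) \<le> e" using ab(1) by (simp add: norm_ball_def field_simps)
    then show "y \<in> cball x e" using ab(4)[of "x - y"] by (simp add: dist_norm)
  qed
  have 2: "cball x (e / b) \<subseteq> norm_ball N x e" for e
  proof
    fix y assume "y \<in> cball x (e / b)"
    then have "b * norm (x - y) \<le> e" using ab(2) by (simp add: dist_norm field_simps)
    then show "y \<in> norm_ball N x e" using ab(3)[of "x - y"] by (simp add: norm_ball_def)
  qed
  have "(\<exists>e>0. norm_ball N x e \<inter> affine hull X \<subseteq> X) \<longleftrightarrow> (\<exists>e>0. cball x e \<inter> affine hull X \<subseteq> X)"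
    (is "?L \<longleftrightarrow> ?R")
  proof
    assume ?L
    then obtain e where "e > 0" "norm_ball N x e \<inter> affine hull X \<subseteq> X" by blast
    then show ?R using 2[of e] ab(2) by (intro exI[of _ "e / b"]) auto
  next
    assume ?R
    then obtain e where "e > 0" "cball x e \<inter> affine hull X \<subseteq> X" by blast
    then show ?L using 1[of e] ab(1) by (intro exI[of _ "e / a"]) auto
  qed
  then show ?thesis by (simp add: mem_rel_interior_cball)
qed

end

theory Submission
  imports Defs
begin

text \<open>
  Each step decreases every \<open>F\<^sub>j\<close> by at least \<open>min (t/2) (t\<^sup>2/(2LD\<^sup>2))\<close>, where \<open>t = -\<theta>(x\<^sub>k)\<close>. Hence a
  limit point \<open>xs\<close> is Pareto critical. As \<open>xs\<close> lies in the relative interior, criticality applies to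
  the direction \<open>p\<^sub>k - x\<^sub>k\<close> even though \<open>xs + p\<^sub>k - x\<^sub>k\<close> need not be feasible: some \<open>j\<close> has
  \<open>\<nabla>F\<^sub>j(xs) \<bullet> (p\<^sub>k - x\<^sub>k) \<ge> 0\<close>. Comparing \<open>F\<^sub>j\<close> at \<open>x\<^sub>k\<close>, \<open>p\<^sub>k\<close> and \<open>xs\<close> for this \<open>j\<close> gives \<open>t \<le> LD\<^sup>2\<close>,
  so the decrease is always at least \<open>t\<^sup>2/(2LD\<^sup>2)\<close>; telescoping yields the bound on the sum. Moving
  from \<open>x\<^sub>k\<close> a distance \<open>r\<close> towards \<open>xs\<close> and using strong convexity gives \<open>t\<^sup>2 \<ge> 2 \<mu> r\<^sup>2 h(x\<^sub>k)\<close> for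
  the minimal gap \<open>h\<close>, hence the linear rate.
\<close>

section \<open>Diameter bound, one-step estimate, and finite maxima and minima\<close>

lemma norm_le_norm_diameter:
  fixes X :: "'a::euclidean_space set"
  assumes "is_norm N" "compact X" "y \<in> X" "z \<in> X"
  shows "N (y - z) \<le> norm_diameter N X"
proof -
  obtain a b where b: "b > 0" "\<And>x. N x \<le> b * norm x"
    using is_norm_equivalent[OF assms(1)] by metis
  obtain B where B: "\<And>x. x \<in> X \<Longrightarrow> norm x \<le> B"
    using compact_imp_bounded[OF assms(2)] unfolding bounded_iff by blast
  have "N (u - v) \<le> b * (B + B)" if "u \<in> X" "v \<in> X" for u v
  proof -
    have "norm (u - v) \<le> B + B"
      using norm_triangle_ineq4[of u v] B[OF that(1)] B[OF that(2)] by linarith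
    then show ?thesis
      using b(2)[of "u - v"] b(1) by (meson mult_left_mono less_imp_le order_trans)
  qed
  then have bdd: "bdd_above ((\<lambda>(x, y). N (x - y)) ` (X \<times> X))"
    by (intro bdd_aboveI[of _ "b * (B + B)"]) auto
  show ?thesis
    using cSUP_upper[OF _ bdd, of "(y, z)"] assms(3,4) by (simp add: norm_diameter_def)
qed

text \<open>The right-hand side is the decrease of the quadratic model. If the step is cut off at 1,
  then \<open>L * n^2 \<le> t\<close> leaves at least \<open>t / 2\<close>; otherwise
  \<open>\<gamma>\<close> is the exact maximiser, with value \<open>t^2 / (2 * L * n^2)\<close>, and
  \<open>n \<le> D\<close> bounds this below.\<close>

lemma short_step_decrease:
  fixes t L n D :: real
  assumes "t > 0" "L > 0" "n > 0" "n \<le> D"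
  defines "\<gamma> \<equiv> min 1 (t / (L * n\<^sup>2))"
  shows "min (t / 2) (t\<^sup>2 / (2 * L * D\<^sup>2)) \<le> \<gamma> * t - L / 2 * (\<gamma> * n)\<^sup>2"
proof (cases "t / (L * n\<^sup>2) \<ge> 1")
  case True
  then have "\<gamma> = 1" "L * n\<^sup>2 \<le> t"
    using assms by (auto simp: field_simps)
  then show ?thesis by simp
next
  case False
  then have \<gamma>: "\<gamma> = t / (L * n\<^sup>2)" by (simp add: \<gamma>_def)
  have "\<gamma> * t - L / 2 * (\<gamma> * n)\<^sup>2 = t\<^sup>2 / (2 * L * n\<^sup>2)"
    unfolding \<gamma> using assms(2,3) by (simp add: field_simps power2_eq_square)
  moreover have "t\<^sup>2 / (2 * L * D\<^sup>2) \<le> t\<^sup>2 / (2 * L * n\<^sup>2)"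
    using assms by (intro divide_left_mono mult_left_mono power_mono) auto
  ultimately show ?thesis by linarith
qed

lemma lin_max_ge:
  "j \<in> {1..m} \<Longrightarrow> gradient (F j) u \<bullet> (y - u) \<le> lin_max m F u y"
  unfolding lin_max_def by (rule Max_ge) auto

lemma lin_max_le:
  assumes "m \<ge> 1" "\<And>j. j \<in> {1..m} \<Longrightarrow> gradient (F j) u \<bullet> (y - u) \<le> c"
  shows "lin_max m F u y \<le> c"
  unfolding lin_max_def using assms by (subst Max_le_iff) auto

lemma min_gap_le: "j \<in> {1..m} \<Longrightarrow> min_gap m F xs y \<le> F j y - F j xs"
  unfolding min_gap_def by (rule Min_le) auto

lemma min_gap_ge:
  assumes "m \<ge> 1" "\<And>j. j \<in> {1..m} \<Longrightarrow> c \<le> F j y - F j xs"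
  shows "c \<le> min_gap m F xs y"
  unfolding min_gap_def using assms by (subst Min_ge_iff) auto

section \<open>Properties of a run: feasibility, descent, criticality of a limit point\<close>

locale mfw_convergent =
  fixes N :: "'a::euclidean_space \<Rightarrow> real"
    and X V :: "'a set"
    and m :: nat
    and F :: "nat \<Rightarrow> 'a \<Rightarrow> real"
    and L :: real
    and x p :: "nat \<Rightarrow> 'a"
    and s :: "nat \<Rightarrow> nat"
    and xs :: 'a
  assumes norm_N: "is_norm N"
    and convex_X: "convex X" and compact_X: "compact X"
    and open_V: "open V" and X_subset_V: "X \<subseteq> V"
    and m_pos: "m \<ge> 1"
    and C1: "\<And>j. j \<in> {1..m} \<Longrightarrow> continuously_differentiable_on V (F j)"
    and smooth: "\<And>j. j \<in> {1..m} \<Longrightarrow> convex_smooth_on N L X (F j)"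
    and L_pos: "L > 0"
    and run: "mfw_run N L m F X x p"
    and strict_mono_s: "strict_mono s" and tendsto_xs: "(x \<circ> s) \<longlonglongrightarrow> xs"
begin

abbreviation "D \<equiv> norm_diameter N X"
abbreviation "t k \<equiv> - lin_max m F (x k) (p k)"
abbreviation "\<gamma> k \<equiv> mfw_step_size N L m F (x k) (p k)"

lemma N_nonneg: "0 \<le> N v" and N_zero: "N v = 0 \<longleftrightarrow> v = 0"
  and N_scale: "N (c *\<^sub>R v) = \<bar>c\<bar> * N v"
  and N_triangle: "N (v + w) \<le> N v + N w"
  using norm_N by (auto simp: is_norm_def)

lemma N_le_D: "y \<in> X \<Longrightarrow> z \<in> X \<Longrightarrow> N (y - z) \<le> D"
  using norm_le_norm_diameter[OF norm_N compact_X] .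

lemma smooth_lower:
  "j \<in> {1..m} \<Longrightarrow> y \<in> X \<Longrightarrow> z \<in> X \<Longrightarrow> F j y + gradient (F j) y \<bullet> (z - y) \<le> F j z"
  using smooth by (auto simp: convex_smooth_on_def)

lemma smooth_upper:
  "j \<in> {1..m} \<Longrightarrow> y \<in> X \<Longrightarrow> z \<in> X \<Longrightarrow>
    F j z \<le> F j y + gradient (F j) y \<bullet> (z - y) + L / 2 * (N (z - y))\<^sup>2"
  using smooth by (auto simp: convex_smooth_on_def)

lemma t_pos: "t k > 0"
  using run by (auto simp: mfw_run_def)

lemma p_in_X: "p k \<in> X"
  using run by (auto simp: mfw_run_def is_arg_min_def)

lemma lin_max_p_le: "y \<in> X \<Longrightarrow> lin_max m F (x k) (p k) \<le> lin_max m F (x k) y"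
  using run by (auto simp: mfw_run_def is_arg_min_def not_less)

lemma x_Suc: "x (Suc k) = x k + \<gamma> k *\<^sub>R (p k - x k)"
  using run by (auto simp: mfw_run_def)

lemma N_step_pos: "0 < N (p k - x k)"
proof -
  \<comment> \<open>A zero direction would make every linearised term vanish, contradicting
    \<open>lin_max < 0\<close>; the step-size denominator is therefore positive.\<close>
  have "p k \<noteq> x k"
  proof
    assume "p k = x k"
    then have "0 \<le> lin_max m F (x k) (p k)"
      using lin_max_ge[of 1 m F "x k" "p k"] m_pos by simp
    then show False using t_pos[of k] by simp
  qed
  then show ?thesis using N_nonneg[of "p k - x k"] N_zero[of "p k - x k"] by fastforce
qed

lemma \<gamma>_nonneg: "0 \<le> \<gamma> k" and \<gamma>_le_1: "\<gamma> k \<le> 1"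
  using t_pos[of k] L_pos by (auto simp: mfw_step_size_def intro!: divide_nonpos_nonneg)

lemma x_in_X: "x k \<in> X"
proof (induction k)
  case 0
  then show ?case using run by (simp add: mfw_run_def)
next
  case (Suc k)
  have "x (Suc k) = (1 - \<gamma> k) *\<^sub>R x k + \<gamma> k *\<^sub>R p k"
    by (simp add: x_Suc algebra_simps)
  then show ?case
    using convexD[OF convex_X Suc p_in_X] \<gamma>_nonneg \<gamma>_le_1 by simp
qed

lemma D_pos: "0 < D"
  using N_step_pos[of 0] N_le_D[OF p_in_X x_in_X, of 0 0] by linarith

lemma decrease_min:
  assumes "j \<in> {1..m}"
  shows "F j (x (Suc k)) \<le> F j (x k) - min (t k / 2) ((t k)\<^sup>2 / (2 * L * D\<^sup>2))"
proof -
  let ?d = "p k - x k"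
  have "gradient (F j) (x k) \<bullet> ?d \<le> - t k"
    using lin_max_ge[OF assms, of F "x k" "p k"] by simp
  then have grad: "\<gamma> k * (gradient (F j) (x k) \<bullet> ?d) \<le> \<gamma> k * (- t k)"
    by (intro mult_left_mono \<gamma>_nonneg)
  have diff: "x (Suc k) - x k = \<gamma> k *\<^sub>R ?d" by (simp add: x_Suc)
  have "F j (x (Suc k)) \<le> F j (x k) + \<gamma> k * (gradient (F j) (x k) \<bullet> ?d) + L / 2 * (\<gamma> k * N ?d)\<^sup>2"
    using smooth_upper[OF assms x_in_X[of k] x_in_X[of "Suc k"]] \<gamma>_nonneg[of k]
    unfolding diff by (simp add: N_scale)
  moreover have "min (t k / 2) ((t k)\<^sup>2 / (2 * L * D\<^sup>2)) \<le> \<gamma> k * t k - L / 2 * (\<gamma> k * N ?d)\<^sup>2"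
    unfolding mfw_step_size_def
    by (rule short_step_decrease[OF t_pos L_pos N_step_pos N_le_D[OF p_in_X x_in_X]])
  ultimately show ?thesis using grad by simp
qed

lemma antimono_F:
  assumes "j \<in> {1..m}"
  shows "antimono (\<lambda>k. F j (x k))"
proof (rule decseq_SucI)
  fix k
  have "0 \<le> min (t k / 2) ((t k)\<^sup>2 / (2 * L * D\<^sup>2))"
    using t_pos[of k] L_pos by simp
  then show "F j (x (Suc k)) \<le> F j (x k)" using decrease_min[OF assms, of k] by linarith
qed

lemma xs_in_X: "xs \<in> X"
  using closed_sequentially[OF compact_imp_closed[OF compact_X] _ tendsto_xs] x_in_X by simp

lemma tendsto_F_xs:
  assumes "j \<in> {1..m}"
  shows "(\<lambda>n. F j (x (s n))) \<longlonglongrightarrow> F j xs"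
proof -
  have "F j differentiable (at xs)"
    using C1[OF assms] xs_in_X X_subset_V by (auto simp: continuously_differentiable_on_def)
  then have "isCont (F j) xs" by (rule differentiable_imp_continuous_within)
  then show ?thesis using isCont_tendsto_compose tendsto_xs by (fastforce simp: o_def)
qed

lemma tendsto_gradient_xs:
  assumes "j \<in> {1..m}"
  shows "(\<lambda>n. gradient (F j) (x (s n))) \<longlonglongrightarrow> gradient (F j) xs"
proof -
  have "isCont (gradient (F j)) xs"
    using C1[OF assms] xs_in_X X_subset_V open_V
    by (auto simp: continuously_differentiable_on_def continuous_on_eq_continuous_at)
  then show ?thesis using isCont_tendsto_compose tendsto_xs by (fastforce simp: o_def)
qed

text \<open>A nonincreasing sequence stays above the limit of any of its subsequences;
  \<open>s n \<ge> n\<close> places every index \<open>k\<close> before late members of the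
  subsequence.\<close>

lemma F_ge_limit:
  assumes "j \<in> {1..m}"
  shows "F j xs \<le> F j (x k)"
proof (rule LIMSEQ_le_const2[OF tendsto_F_xs[OF assms]], intro exI allI impI)
  fix n assume "k \<le> n"
  then have "k \<le> s n" using seq_suble[OF strict_mono_s, of n] by linarith
  then show "F j (x (s n)) \<le> F j (x k)"
    using antimono_F[OF assms] by (simp add: antimono_def)
qed

text \<open>If \<open>y\<close> gave descent for all objectives at \<open>xs\<close>, continuity of
  the gradients would keep \<open>t (s n)\<close> above a fixed \<open>c\<close>. Each such step
  lowers \<open>F 1\<close> by a fixed \<open>\<delta>\<close>, yet \<open>F 1 (x (s n))\<close>
  tends to \<open>F 1 xs\<close>, a lower bound for the whole run.\<close>

lemma limit_critical:
  assumes "y \<in> X"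
  shows "0 \<le> lin_max m F xs y"
proof (rule ccontr)
  assume "\<not> ?thesis"
  \<comment> \<open>Halving leaves a strict margin at \<open>xs\<close>, so the inequality persists
    at nearby iterates.\<close>
  moreover define c where "c = - lin_max m F xs y / 2"
  ultimately have c: "c > 0" "lin_max m F xs y < - c" by auto
  have ev1: "\<forall>\<^sub>F n in sequentially. gradient (F j) (x (s n)) \<bullet> (y - x (s n)) < - c"
    if j: "j \<in> {1..m}" for j
  proof (rule order_tendstoD(2))
    show "(\<lambda>n. gradient (F j) (x (s n)) \<bullet> (y - x (s n))) \<longlonglongrightarrow> gradient (F j) xs \<bullet> (y - xs)"
      using tendsto_xs by (intro tendsto_intros tendsto_gradient_xs[OF j]) (simp add: o_def)
    show "gradient (F j) xs \<bullet> (y - xs) < - c"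
      using lin_max_ge[OF j, of F xs y] c by simp
  qed
  have "\<forall>\<^sub>F n in sequentially. \<forall>j\<in>{1..m}. gradient (F j) (x (s n)) \<bullet> (y - x (s n)) < - c"
    using ev1 by (intro eventually_ball_finite) auto
  then have ev: "\<forall>\<^sub>F n in sequentially. t (s n) \<ge> c"
  proof eventually_elim
    case (elim n)
    have "lin_max m F (x (s n)) y \<le> - c"
      using elim by (intro lin_max_le[OF m_pos] less_imp_le) auto
    then show ?case using lin_max_p_le[OF assms, of "s n"] by simp
  qed
  define \<delta> where "\<delta> = min (c / 2) (c\<^sup>2 / (2 * L * D\<^sup>2))"
  have \<delta>: "\<delta> > 0" using c L_pos D_pos by (simp add: \<delta>_def)
  have one: "1 \<in> {1..m}" using m_pos by simp
  have ev_ge: "\<forall>\<^sub>F n in sequentially. F 1 xs + \<delta> \<le> F 1 (x (s n))"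
    using ev
  proof eventually_elim
    case (elim n)
    have "c\<^sup>2 / (2 * L * D\<^sup>2) \<le> (t (s n))\<^sup>2 / (2 * L * D\<^sup>2)"
      using elim c L_pos by (intro divide_right_mono power_mono) auto
    moreover have "c / 2 \<le> t (s n) / 2" using elim by simp
    ultimately have "\<delta> \<le> min (t (s n) / 2) ((t (s n))\<^sup>2 / (2 * L * D\<^sup>2))"
      unfolding \<delta>_def by (rule min.mono[rotated])
    then show ?case
      using decrease_min[OF one, of "s n"] F_ge_limit[OF one, of "Suc (s n)"] by linarith
  qed
  have "F 1 xs + \<delta> \<le> F 1 xs"
    using tendsto_lowerbound[OF tendsto_F_xs[OF one] ev_ge] by simp
  then show False using \<delta> by simp
qed

section \<open>Relative-interior limit point: bound on \<open>t\<close>, sum bound, linear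
  rate\<close>

context
  fixes r :: real
  assumes r_pos: "r > 0"
    and ball_subset: "norm_ball N xs (2 * r) \<inter> affine hull X \<subseteq> X"
begin

lemma t_le: "t k \<le> L * D\<^sup>2"
proof -
  let ?v = "p k - x k"
  \<comment> \<open>Since \<open>N ?v \<le> D\<close>, this scaling keeps
    \<open>xs + e *\<^sub>R ?v\<close> in the ball of radius \<open>2 * r\<close>; a difference of
    points of \<open>X\<close> keeps it in the affine hull.\<close>
  define e where "e = 2 * r / D"
  have e: "e > 0" using r_pos D_pos by (simp add: e_def)
  define y where "y = xs + e *\<^sub>R ?v"
  have "N (xs - y) = e * N ?v"
    using N_scale[of "- e" ?v] e by (simp add: y_def)
  also have "\<dots> \<le> e * D" using e by (intro mult_left_mono N_le_D p_in_X x_in_X) auto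
  also have "\<dots> = 2 * r" using D_pos by (simp add: e_def)
  finally have "y \<in> norm_ball N xs (2 * r)" by (simp add: norm_ball_def)
  moreover have "y \<in> affine hull X"
    unfolding y_def
    by (intro mem_affine_3_minus affine_affine_hull hull_inc xs_in_X p_in_X x_in_X)
  ultimately have "y \<in> X" using ball_subset by blast
  then have "0 \<le> lin_max m F xs y" by (rule limit_critical)
  \<comment> \<open>The maximum is attained, so criticality singles out one index \<open>j\<close>,
    which may depend on \<open>k\<close>.\<close>
  moreover have "lin_max m F xs y \<in> (\<lambda>j. gradient (F j) xs \<bullet> (y - xs)) ` {1..m}"
    unfolding lin_max_def using m_pos by (intro Max_in) auto
  ultimately obtain j where j: "j \<in> {1..m}" "0 \<le> gradient (F j) xs \<bullet> (y - xs)"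
    by auto
  then have crit: "0 \<le> gradient (F j) xs \<bullet> ?v"
    using e by (simp add: y_def zero_le_mult_iff)
  have sq: "L / 2 * (N (u - w))\<^sup>2 \<le> L / 2 * D\<^sup>2" if "u \<in> X" "w \<in> X" for u w
    using L_pos N_le_D[OF that] N_nonneg by (intro mult_left_mono power_mono) auto
  \<comment> \<open>Two upper estimates, from \<open>x k\<close> to \<open>p k\<close> and from
    \<open>xs\<close> to \<open>x k\<close>, cost \<open>L / 2 * D^2\<close> each. Against the
    convexity bound from \<open>xs\<close> to \<open>p k\<close>, the gradient terms at
    \<open>xs\<close> combine to the inner product with \<open>?v\<close>, which is
    nonnegative.\<close>
  have "F j (p k) \<le> F j (x k) - t k + L / 2 * D\<^sup>2"
    using smooth_upper[OF j(1) x_in_X[of k] p_in_X[of k]] lin_max_ge[OF j(1), of F "x k" "p k"]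
      sq[OF p_in_X[of k] x_in_X[of k]] by linarith
  moreover have "F j (x k) \<le> F j xs + gradient (F j) xs \<bullet> (x k - xs) + L / 2 * D\<^sup>2"
    using smooth_upper[OF j(1) xs_in_X x_in_X[of k]] sq[OF x_in_X[of k] xs_in_X] by linarith
  moreover have "F j xs + gradient (F j) xs \<bullet> (p k - xs) \<le> F j (p k)"
    by (rule smooth_lower[OF j(1) xs_in_X p_in_X])
  ultimately show ?thesis using crit by (simp add: inner_diff_right)
qed

text \<open>By \<open>t_le\<close> the quadratic term is the smaller one in
  \<open>decrease_min\<close>. The decrease is the same for every \<open>j\<close>, so the minimum
  inherits it even when the minimising index changes.\<close>

lemma min_gap_decrease:
  "min_gap m F xs (x (Suc k)) \<le> min_gap m F xs (x k) - (t k)\<^sup>2 / (2 * L * D\<^sup>2)"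
proof -
  have LD: "L * D\<^sup>2 > 0" using L_pos D_pos by simp
  have "t k * t k \<le> t k * (L * D\<^sup>2)" using t_le t_pos by (intro mult_left_mono) (auto intro: less_imp_le)
  then have "(t k)\<^sup>2 / (2 * L * D\<^sup>2) \<le> t k / 2"
    using LD by (simp add: field_simps power2_eq_square)
  then have dec: "F j (x (Suc k)) \<le> F j (x k) - (t k)\<^sup>2 / (2 * L * D\<^sup>2)" if "j \<in> {1..m}" for j
    using decrease_min[OF that, of k] by (simp add: min_absorb2)
  have "min_gap m F xs (x (Suc k)) + (t k)\<^sup>2 / (2 * L * D\<^sup>2) \<le> F j (x k) - F j xs"
    if "j \<in> {1..m}" for j
    using dec[OF that] min_gap_le[OF that, of F xs "x (Suc k)"] by linarith
  then have "min_gap m F xs (x (Suc k)) + (t k)\<^sup>2 / (2 * L * D\<^sup>2) \<le> min_gap m F xs (x k)"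
    by (rule min_gap_ge[OF m_pos])
  then show ?thesis by linarith
qed

lemma min_gap_nonneg: "0 \<le> min_gap m F xs (x k)"
  using F_ge_limit by (intro min_gap_ge[OF m_pos]) simp

lemma sum_sq_le:
  assumes "l \<le> k"
  shows "(\<Sum>i=l..k. (t i)\<^sup>2) \<le> 2 * L * D\<^sup>2 * min_gap m F xs (x l)"
proof -
  have LD: "2 * L * D\<^sup>2 > 0" using L_pos D_pos by simp
  have "(\<Sum>i=l..k. (t i)\<^sup>2 / (2 * L * D\<^sup>2))
      \<le> (\<Sum>i=l..k. min_gap m F xs (x i) - min_gap m F xs (x (Suc i)))"
    using min_gap_decrease by (intro sum_mono) (simp add: le_diff_eq diff_le_eq add.commute)
  also have "\<dots> = min_gap m F xs (x l) - min_gap m F xs (x (Suc k))"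
    \<comment> \<open>Negating the gap turns current minus next into the next minus current form of
      the telescoping rule.\<close>
    using sum_Suc_diff[of l "Suc k" "\<lambda>i. - min_gap m F xs (x i)"] assms
    by (simp add: sum_subtractf sum_negf)
  also have "\<dots> \<le> min_gap m F xs (x l)" using min_gap_nonneg by simp
  finally show ?thesis
    using LD by (simp add: sum_divide_distrib[symmetric] pos_divide_le_eq mult.commute)
qed

text \<open>Probing the subproblem at distance \<open>r\<close> from \<open>x k\<close> towards
  \<open>xs\<close> bounds \<open>t k\<close> below by a sum of two terms depending on the unknown
  distance \<open>n\<close>; the arithmetic-geometric mean inequality removes
  \<open>n\<close>.\<close>

lemma t_sq_ge:
  assumes \<mu>: "\<mu> > 0"
    and strong: "\<And>j. j \<in> {1..m} \<Longrightarrow> strongly_convex_with N \<mu> X (F j)"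
    and near: "x k \<in> norm_ball N xs r"
  shows "2 * \<mu> * r\<^sup>2 * min_gap m F xs (x k) \<le> (t k)\<^sup>2"
proof (cases "x k = xs")
  case True
  then have "min_gap m F xs (x k) \<le> 0"
    using min_gap_le[of 1 m F xs "x k"] m_pos by simp
  then have "2 * \<mu> * r\<^sup>2 * min_gap m F xs (x k) \<le> 0"
    using \<mu> by (simp add: mult_nonneg_nonpos)
  then show ?thesis by (meson order_trans zero_le_power2)
next
  case False
  let ?h = "min_gap m F xs (x k)" and ?w = "xs - x k"
  define n where "n = N ?w"
  have n: "n > 0" using False N_nonneg[of ?w] N_zero[of ?w] unfolding n_def by fastforce
  \<comment> \<open>The point has distance \<open>r\<close> from \<open>x k\<close> and may lie
    beyond \<open>xs\<close>; the triangle inequality puts it within \<open>2 * r\<close> of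
    \<open>xs\<close>, hence in \<open>X\<close>.\<close>
  define y where "y = x k + (r / n) *\<^sub>R ?w"
  have "N (x k - y) = r"
    using N_scale[of "- (r / n)" ?w] n r_pos by (simp add: y_def n_def)
  then have "N (xs - y) \<le> 2 * r"
    using N_triangle[of "xs - x k" "x k - y"] near by (simp add: norm_ball_def)
  moreover have "y \<in> affine hull X"
    unfolding y_def
    by (intro mem_affine_3_minus affine_affine_hull hull_inc xs_in_X x_in_X)
  ultimately have y: "y \<in> X" using ball_subset by (auto simp: norm_ball_def)
  let ?q = "r / n * (?h + \<mu> / 2 * n\<^sup>2)"
  have "lin_max m F (x k) y \<le> - ?q"
  proof (rule lin_max_le[OF m_pos])
    fix j assume j: "j \<in> {1..m}"
    have "F j (x k) + gradient (F j) (x k) \<bullet> ?w + \<mu> / 2 * n\<^sup>2 \<le> F j xs"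
      \<comment> \<open>Strong convexity bounds the slope towards \<open>xs\<close> through the gap
        of \<open>F j\<close>; replacing that gap by the minimal one makes the bound uniform in
        \<open>j\<close>.\<close>
      using strong[OF j] x_in_X[of k] xs_in_X by (auto simp: strongly_convex_with_def n_def)
    then have "gradient (F j) (x k) \<bullet> ?w \<le> - (?h + \<mu> / 2 * n\<^sup>2)"
      using min_gap_le[OF j, of F xs "x k"] by linarith
    then have "r / n * (gradient (F j) (x k) \<bullet> ?w) \<le> r / n * - (?h + \<mu> / 2 * n\<^sup>2)"
      using r_pos n by (intro mult_left_mono) auto
    then show "gradient (F j) (x k) \<bullet> (y - x k) \<le> - ?q"
      by (simp only: y_def add_diff_cancel_left' inner_scaleR_right mult_minus_right)
  qed
  then have q: "?q \<le> t k" using lin_max_p_le[OF y, of k] by linarith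
  have "0 \<le> ?q" using r_pos n \<mu> min_gap_nonneg[of k] by simp
  then have "?q\<^sup>2 \<le> (t k)\<^sup>2" using q by (intro power_mono)
  moreover have "2 * \<mu> * r\<^sup>2 * ?h \<le> ?q\<^sup>2"
  proof -
    \<comment> \<open>This is \<open>(a + b)^2 - 4 * a * b = (a - b)^2\<close> with
      \<open>a = ?h\<close> and \<open>b = \<mu> / 2 * n^2\<close>, scaled by
      \<open>(r / n)^2\<close>.\<close>
    have "?q\<^sup>2 - 2 * \<mu> * r\<^sup>2 * ?h = (r / n * (?h - \<mu> / 2 * n\<^sup>2))\<^sup>2"
      using n by (simp add: field_simps power2_eq_square)
    then show ?thesis using zero_le_power2[of "r / n * (?h - \<mu> / 2 * n\<^sup>2)"] by linarith
  qed
  ultimately show ?thesis by linarith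
qed

lemma min_gap_linear_rate:
  assumes "\<mu> > 0" "\<And>j. j \<in> {1..m} \<Longrightarrow> strongly_convex_with N \<mu> X (F j)"
    and "x k \<in> norm_ball N xs r"
  shows "min_gap m F xs (x (Suc k)) \<le> (1 - \<mu> * r\<^sup>2 / (L * D\<^sup>2)) * min_gap m F xs (x k)"
proof -
  have "2 * L * D\<^sup>2 > 0" using L_pos D_pos by simp
  then have "2 * \<mu> * r\<^sup>2 * min_gap m F xs (x k) / (2 * L * D\<^sup>2) \<le> (t k)\<^sup>2 / (2 * L * D\<^sup>2)"
    using t_sq_ge[OF assms] by (intro divide_right_mono) auto
  then show ?thesis using min_gap_decrease[of k] by (simp add: algebra_simps)
qed

end

end

section \<open>Uniform constants for all objectives, and assembly\<close>

lemma convex_smooth_on_mono: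
  assumes "convex_smooth_on N L X f" "L \<le> L'"
  shows "convex_smooth_on N L' X f"
  unfolding convex_smooth_on_def
proof (intro ballI conjI)
  fix y z assume yz: "y \<in> X" "z \<in> X"
  have "L / 2 * (N (z - y))\<^sup>2 \<le> L' / 2 * (N (z - y))\<^sup>2"
    using assms(2) by (intro mult_right_mono) auto
  then show "f z \<le> f y + gradient f y \<bullet> (z - y) + L' / 2 * (N (z - y))\<^sup>2"
    using assms(1) yz by (fastforce simp: convex_smooth_on_def)
  show "f y + gradient f y \<bullet> (z - y) \<le> f z"
    using assms(1) yz by (auto simp: convex_smooth_on_def)
qed

lemma strongly_convex_with_antimono:
  assumes "strongly_convex_with N \<mu> X f" "\<mu>' \<le> \<mu>"
  shows "strongly_convex_with N \<mu>' X f"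
  unfolding strongly_convex_with_def
proof (intro ballI)
  fix y z assume yz: "y \<in> X" "z \<in> X"
  have "\<mu>' / 2 * (N (z - y))\<^sup>2 \<le> \<mu> / 2 * (N (z - y))\<^sup>2"
    using assms(2) by (intro mult_right_mono) auto
  then show "f z \<ge> f y + gradient f y \<bullet> (z - y) + \<mu>' / 2 * (N (z - y))\<^sup>2"
    using assms(1) yz by (fastforce simp: strongly_convex_with_def)
qed

theorem theorem6:
  fixes N :: "'a::euclidean_space \<Rightarrow> real"
    and X V :: "'a set"
    and m k0 :: nat
    and F :: "nat \<Rightarrow> 'a \<Rightarrow> real"
    and Lc \<mu>c :: "nat \<Rightarrow> real"
    and L \<mu> r :: real
    and x p :: "nat \<Rightarrow> 'a"
    and xs :: 'a
  assumes "is_norm N"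
    and "X \<noteq> {}" "convex X" "compact X"
    and "open V" "X \<subseteq> V"
    and "m \<ge> 1"
    and "\<And>j. j \<in> {1..m} \<Longrightarrow> convex_on V (F j)"
    and "\<And>j. j \<in> {1..m} \<Longrightarrow> continuously_differentiable_on V (F j)"
    and "\<And>j. j \<in> {1..m} \<Longrightarrow> convex_smooth_on N (Lc j) X (F j)"
    and "L = (MAX j\<in>{1..m}. Lc j)" "L > 0"
    and "\<And>j. j \<in> {1..m} \<Longrightarrow> \<mu>c j > 0"
    and "\<And>j. j \<in> {1..m} \<Longrightarrow> strongly_convex_with N (\<mu>c j) X (F j)"
    and "\<mu> = (MIN j\<in>{1..m}. \<mu>c j)"
    and "mfw_run N L m F X x p"
    and "\<exists>s. strict_mono s \<and> (x \<circ> s) \<longlonglongrightarrow> xs"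
    and "xs \<in> rel_interior X"
    and "r > 0"
    and "norm_ball N xs (2 * r) \<inter> affine hull X \<subseteq> X"
    and "\<And>k. k \<ge> k0 \<Longrightarrow> x k \<in> norm_ball N xs r"
  shows "(\<forall>k\<ge>k0. min_gap m F xs (x (Suc k))
            \<le> (1 - \<mu> * r\<^sup>2 / (L * (norm_diameter N X)\<^sup>2)) * min_gap m F xs (x k))
       \<and> (\<forall>l\<ge>1. \<forall>k\<ge>l. (\<Sum>i=l..k. \<bar>lin_max m F (x i) (p i)\<bar>\<^sup>2)
            \<le> 2 * L * (norm_diameter N X)\<^sup>2 * min_gap m F xs (x l))"
proof -
  obtain s where s: "strict_mono s" "(x \<circ> s) \<longlonglongrightarrow> xs" using assms(17) by blast
  have smooth: "convex_smooth_on N L X (F j)" if "j \<in> {1..m}" for j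
    by (rule convex_smooth_on_mono[OF assms(10)[OF that]]) (use that in \<open>auto simp: assms(11)\<close>)
  have strong: "strongly_convex_with N \<mu> X (F j)" if "j \<in> {1..m}" for j
    by (rule strongly_convex_with_antimono[OF assms(14)[OF that]])
      (use that in \<open>auto simp: assms(15)\<close>)
  have \<mu>: "\<mu> > 0" using assms(7,13) by (auto simp: assms(15) Min_gr_iff)
  interpret mfw_convergent N X V m F L x p s xs
    by unfold_locales (use assms smooth s in blast)+
  show ?thesis
    using min_gap_linear_rate[OF \<open>r > 0\<close> assms(20) \<mu> strong assms(21)]
      sum_sq_le[OF \<open>r > 0\<close> assms(20)] by simp
qed

end
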